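(* Let $p\geq 3$ be a prime, let $w=e^{2\pi i/p}$, and for $F\in\mathbb Z[x,y]$ put $$M_{\mathbb Z_p^2}(F)=\prod_{i=0}^{p-1}\prod_{j=0}^{p-1}F(w^i,w^j)\in\mathbb Z .$$ If $p\mid M_{\mathbb Z_p^2}(F)$ then $p^{p+3}\mid M_{\mathbb Z_p^2}(F)$. Moreover, for every integer $k\geq 0$ there exists $F\in\mathbb Z[x,y]$ with $p^{p+3+k}\parallel M_{\mathbb Z_p^2}(F)$ (i.e. $p^{p+3+k}$ divides it but $p^{p+4+k}$ does not).
   Context: $M_{\mathbb Z_p^2}(F)$ is the integer group determinant of the group $\mathbb Z_p\times\mathbb Z_p$ evaluated at the coefficients of $F$ (reduced modulo $x^p-1,y^p-1$). The notation $p^e\parallel N$ means $p^e\mid N$ and $p^{e+1}\nmid N$. *)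

theory Defs
  imports Complex_Main "HOL-Computational_Algebra.Computational_Algebra"
begin

text \<open>
  An element of \<open>\<int>[x, y]\<close> is represented as an element of \<open>\<int>[x][y]\<close>, i.e. as an
  \<open>int poly poly\<close>: the coefficient of \<open>x\<^sup>i y\<^sup>j\<close> in \<open>F\<close> is \<open>coeff (coeff F j) i\<close>.
  Thus \<open>eval_xy F a b\<close> is \<open>F(a, b)\<close>: the inner variable \<open>x\<close> is set to \<open>a\<close> and
  the outer variable \<open>y\<close> to \<open>b\<close>.
\<close>

definition eval_xy :: "int poly poly \<Rightarrow> complex \<Rightarrow> complex \<Rightarrow> complex" where
  "eval_xy F a b = poly (map_poly (\<lambda>q. poly (map_poly of_int q) a) F) b"

definition unity_root :: "nat \<Rightarrow> complex" where
  "unity_root p = exp (2 * of_real pi * \<i> / of_nat p)"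

text \<open>
  The group determinant of \<open>\<int>\<^sub>p \<times> \<int>\<^sub>p\<close> as a complex number; that its value is an
  integer is a fact to be proved, not part of the definition.
\<close>

definition group_det_Zp2 :: "nat \<Rightarrow> int poly poly \<Rightarrow> complex" where
  "group_det_Zp2 p F =
     (\<Prod>i = 0..p - 1. \<Prod>j = 0..p - 1. eval_xy F (unity_root p ^ i) (unity_root p ^ j))"

end

theory Submission
  imports Defs "HOL-Analysis.Complex_Transcendental" "HOL-Number_Theory.Cong"
begin

text \<open>
  Write \<open>N f = \<Prod>\<^sub>j f(w\<^sup>j)\<close>, \<open>0 < j < p\<close>, for \<open>f \<in> \<int>[x]\<close>. Grouping the points \<open>(w\<^sup>i, w\<^sup>j)\<close> by lines
  through the origin gives
  \<open>M(F) = F(1,1) \<cdot> N(F(1,x)) \<cdot> \<Prod>\<^sub>t N(F(x,x\<^sup>t))\<close>, \<open>0 \<le> t < p\<close>.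
  Each \<open>N f\<close> is an integer congruent to \<open>f(1)\<^bsup>p-1\<^esup>\<close> modulo \<open>p\<close>, so \<open>p\<close> divides one of the \<open>p + 2\<close>
  factors only if it divides all of them. If \<open>p\<close> divides \<open>f(1)\<close>, then \<open>f\<close> agrees with some
  \<open>(x - 1) g\<close> at all \<open>w\<^sup>j\<close> with \<open>j \<noteq> 0\<close>, where \<open>g(1) \<equiv> f'(1)\<close>, hence \<open>N f = p N g\<close>, and \<open>p\<^sup>2\<close> divides
  \<open>N f\<close> iff \<open>p\<close> divides \<open>f'(1)\<close>. For the \<open>p + 1\<close> lines these derivatives are \<open>b\<close> and \<open>a + t b\<close> with
  \<open>a = F\<^sub>x(1,1)\<close> and \<open>b = F\<^sub>y(1,1)\<close>, and one of them vanishes modulo \<open>p\<close>; this is the extra factor.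
  The polynomial \<open>(x - 1) + (y - 1)\<^sup>2 + p\<^sup>k (1 + y + \<dots> + y\<^bsup>p-1\<^esup>)\<close> attains the exponent \<open>p + 3 + k\<close>.
\<close>

subsection \<open>Evaluating integer polynomials at complex numbers\<close>

definition ipoly :: "int poly \<Rightarrow> complex \<Rightarrow> complex" where
  "ipoly f z = poly (map_poly of_int f) z"

lemma ipoly_0 [simp]: "ipoly 0 z = 0"
  by (simp add: ipoly_def)

lemma ipoly_1 [simp]: "ipoly 1 z = 1"
  by (simp add: ipoly_def)

lemma ipoly_pCons [simp]: "ipoly (pCons a f) z = of_int a + z * ipoly f z"
  by (simp add: ipoly_def map_poly_pCons)

lemma ipoly_add [simp]: "ipoly (f + g) z = ipoly f z + ipoly g z"
  by (induction f g rule: poly_induct2) (simp_all add: algebra_simps)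

lemma ipoly_smult [simp]: "ipoly (smult c f) z = of_int c * ipoly f z"
  by (induction f) (simp_all add: algebra_simps)

lemma ipoly_mult [simp]: "ipoly (f * g) z = ipoly f z * ipoly g z"
  by (induction f) (simp_all add: algebra_simps)

lemma ipoly_sum [simp]: "ipoly (sum f A) z = (\<Sum>i\<in>A. ipoly (f i) z)"
  by (induction A rule: infinite_finite_induct) simp_all

lemma ipoly_prod [simp]: "ipoly (prod f A) z = (\<Prod>i\<in>A. ipoly (f i) z)"
  by (induction A rule: infinite_finite_induct) simp_all

lemma ipoly_monom [simp]: "ipoly (monom c n) z = of_int c * z ^ n"
  by (simp add: ipoly_def map_poly_monom poly_monom)

lemma ipoly_pcompose [simp]: "ipoly (pcompose f g) z = ipoly f (ipoly g z)"
  by (induction f) (simp_all add: pcompose_pCons)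

lemma ipoly_of_1: "ipoly f 1 = of_int (poly f 1)"
  by (induction f) simp_all

lemma eval_xy_0 [simp]: "eval_xy 0 a b = 0"
  by (simp add: eval_xy_def)

lemma eval_xy_pCons [simp]: "eval_xy (pCons f F) a b = ipoly f a + b * eval_xy F a b"
  by (simp add: eval_xy_def map_poly_pCons ipoly_def)

lemma eval_xy_line: "eval_xy F z (z ^ t) = ipoly (poly F (monom 1 t)) z"
  by (induction F) simp_all

lemma eval_xy_1: "eval_xy F 1 z = ipoly (map_poly (\<lambda>q. poly q 1) F) z"
  by (induction F) (simp_all add: map_poly_pCons ipoly_of_1)

text \<open>Chain rule at the point \<open>(1,1)\<close>: \<open>poly F 1\<close> is the restriction
  of \<open>F\<close> to \<open>y = 1\<close> and the \<open>map_poly\<close> term its restriction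
  to \<open>x = 1\<close>, so their derivatives are the two partial derivatives.\<close>

lemma poly_pderiv_line:
  "poly (pderiv (poly F (monom 1 t))) 1 =
     poly (pderiv (poly F 1)) 1 + int t * poly (pderiv (map_poly (\<lambda>q. poly q 1) F)) 1"
proof (induction F)
  case (pCons f F)
  \<comment> \<open>The product rule brings in the tail \<open>F\<close> itself, so its values at
    \<open>(1,1)\<close> along the different restrictions must be identified.\<close>
  have "poly (poly F (monom 1 t)) 1 = poly (map_poly (\<lambda>q. poly q 1) F) (1 :: int)"
    by (induction F) (simp_all add: map_poly_pCons poly_monom)
  moreover have "poly (poly F 1) 1 = poly (map_poly (\<lambda>q. poly q 1) F) (1 :: int)"
    by (induction F) (simp_all add: map_poly_pCons)
  ultimately show ?case using pCons
    by (simp add: map_poly_pCons pderiv_pCons pderiv_add pderiv_mult pderiv_monom poly_monom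
        algebra_simps)
qed simp_all

lemma poly_line_1: "poly (poly F (monom 1 t)) 1 = poly (poly F 1) (1 :: int)"
  by (induction F) (simp_all add: poly_monom)

lemma poly_map_poly_1: "poly (map_poly (\<lambda>q. poly q 1) F) 1 = poly (poly F 1) (1 :: int)"
  by (induction F) (simp_all add: map_poly_pCons)

subsection \<open>Norms from the cyclotomic field\<close>

locale odd_prime =
  fixes p :: nat
  assumes prime: "prime p" and ge_3: "p \<ge> 3"
begin

abbreviation w :: complex where "w \<equiv> unity_root p"

section \<open>Powers of the primitive \<open>p\<close>-th root of unity\<close>

lemma w_power_eq_1_iff: "w ^ n = 1 \<longleftrightarrow> p dvd n"
proof -
  have "w ^ n = exp (2 * of_real pi * \<i> * of_nat n / of_nat p)"
    by (simp add: unity_root_def exp_of_nat_mult [symmetric] mult_ac)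
  then show ?thesis
    using complex_root_unity_eq_1 [of p n] ge_3 by simp
qed

lemma w_power_mod: "w ^ (n mod p) = w ^ n"
proof -
  have "w ^ n = w ^ (p * (n div p) + n mod p)" by simp
  also have "\<dots> = w ^ (n mod p)"
    using w_power_eq_1_iff[of p] by (simp only: power_add power_mult) simp
  finally show ?thesis ..
qed

lemma inj_w_power: "inj_on (\<lambda>j. w ^ j) {..<p}"
proof (rule linorder_inj_onI)
  fix i j assume "i < j" and ij: "i \<in> {..<p}" "j \<in> {..<p}"
  have "w \<noteq> 0" by (simp add: unity_root_def)
  moreover have "w ^ j = w ^ i * w ^ (j - i)"
    using \<open>i < j\<close> by (simp flip: power_add)
  moreover have "w ^ (j - i) \<noteq> 1"
    using \<open>i < j\<close> ij by (auto simp: w_power_eq_1_iff dest: dvd_imp_le)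
  ultimately show "w ^ i \<noteq> w ^ j" by simp
qed auto

lemma bij_betw_mult_mod:
  assumes "a \<in> {1..<p}"
  shows "bij_betw (\<lambda>j. a * j mod p) {1..<p} {1..<p}"
proof -
  have cop: "coprime a p"
    using assms prime_imp_coprime[OF prime, of a]
    by (metis atLeastLessThan_iff coprime_commute less_le_not_le nat_dvd_not_less not_one_le_zero
        bot_nat_0.not_eq_extremum)
  have "inj_on (\<lambda>j. a * j mod p) {1..<p}"
  proof (rule inj_onI)
    fix i j assume ij: "i \<in> {1..<p}" "j \<in> {1..<p}" and "a * i mod p = a * j mod p"
    then have "[i = j] (mod p)"
      using cop by (simp add: cong_def [symmetric] cong_mult_lcancel_nat)
    then show "i = j" using ij by (simp add: cong_def)
  qed
  moreover have "(\<lambda>j. a * j mod p) ` {1..<p} \<subseteq> {1..<p}"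
  proof safe
    fix j assume "j \<in> {1..<p}"
    then have "\<not> p dvd j" by (auto dest: dvd_imp_le)
    then have "\<not> p dvd a * j"
      using cop by (simp add: coprime_commute coprime_dvd_mult_right_iff)
    then show "a * j mod p \<in> {1..<p}"
      using ge_3 by (simp add: dvd_eq_mod_eq_0 Suc_le_eq)
  qed
  ultimately show ?thesis
    by (simp add: bij_betw_def endo_inj_surj)
qed

lemma prod_w_mult:
  assumes "a \<in> {1..<p}"
  shows "(\<Prod>j\<in>{1..<p}. f (w ^ (a * j))) = (\<Prod>j\<in>{1..<p}. f (w ^ j))"
  using prod.reindex_bij_betw [OF bij_betw_mult_mod[OF assms], of "\<lambda>j. f (w ^ j)"]
  by (simp add: w_power_mod)

lemma sum_w_power: "(\<Sum>a<p. (w ^ a) ^ k) = (if p dvd k then of_nat p else 0)"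
proof (cases "p dvd k")
  case True
  then have "(w ^ a) ^ k = 1" for a
    by (simp add: power_mult [symmetric] w_power_eq_1_iff)
  with True show ?thesis by simp
next
  case False
  then have "w ^ k \<noteq> 1" by (simp add: w_power_eq_1_iff)
  moreover have "(w ^ k) ^ p = 1"
    by (simp add: power_mult [symmetric] w_power_eq_1_iff)
  moreover have "(\<Sum>a<p. (w ^ a) ^ k) = (\<Sum>a<p. (w ^ k) ^ a)"
    by (simp add: power_mult [symmetric] mult.commute)
  ultimately show ?thesis
    using False by (simp add: geometric_sum)
qed

text \<open>By orthogonality only exponents divisible by \<open>p\<close> survive, each contributing
  \<open>p\<close> times its coefficient. The weight with exponent \<open>m\<close> makes the
  induction work, since \<open>pCons\<close> shifts exponents by one.\<close>

lemma sum_ipoly_w: "\<exists>c. (\<Sum>a<p. (w ^ a) ^ m * ipoly f (w ^ a)) = of_int (int p * c)"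
proof (induction f arbitrary: m)
  case (pCons c f)
  from pCons.IH[of "Suc m"] obtain d where
    "(\<Sum>a<p. (w ^ a) ^ Suc m * ipoly f (w ^ a)) = of_int (int p * d)" by blast
  moreover have "(\<Sum>a<p. (w ^ a) ^ m * ipoly (pCons c f) (w ^ a)) =
      of_int c * (\<Sum>a<p. (w ^ a) ^ m) + (\<Sum>a<p. (w ^ a) ^ Suc m * ipoly f (w ^ a))"
    by (simp add: sum_distrib_left sum.distrib [symmetric] algebra_simps)
  ultimately have "(\<Sum>a<p. (w ^ a) ^ m * ipoly (pCons c f) (w ^ a)) =
      of_int (int p * ((if p dvd m then c else 0) + d))"
    by (simp add: sum_w_power algebra_simps)
  then show ?case by blast
qed (auto intro: exI[of _ 0])

section \<open>Integrality and basic values of the norm\<close>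

lemma lessThan_p: "{..<p} = insert 0 {1..<p}"
  using ge_3 by auto

text \<open>The field norm of \<open>f(w)\<close>. Floor and real part only turn a complex number
  into an \<open>int\<close>; they lose nothing because the product is an integer.\<close>

definition cyc_norm :: "int poly \<Rightarrow> int" where
  "cyc_norm f = \<lfloor>Re (\<Prod>j\<in>{1..<p}. ipoly f (w ^ j))\<rfloor>"

lemma prod_ipoly_w:
  "\<exists>c. (\<Prod>j\<in>{1..<p}. ipoly f (w ^ j)) = of_int (poly f 1 ^ (p - 1) - int p * c)"
proof -
  \<comment> \<open>\<open>P\<close> takes the same value \<open>N\<close> at every nontrivial root
    of unity, because multiplication by \<open>a\<close> permutes the nonzero residues.\<close>
  define P where "P = (\<Prod>j\<in>{1..<p}. pcompose f (monom 1 j))"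
  define N where "N = (\<Prod>j\<in>{1..<p}. ipoly f (w ^ j))"
  have "ipoly P (w ^ a) = N" if "a \<in> {1..<p}" for a
    using prod_w_mult[OF that, of "ipoly f"] by (simp add: P_def N_def power_mult)
  moreover have "ipoly P 1 = of_int (poly f 1 ^ (p - 1))"
    by (simp add: P_def) (simp add: ipoly_of_1)
  \<comment> \<open>Summing \<open>x P(x)\<close> over all \<open>p\<close>-th roots of unity expresses \<open>P(1) - N\<close> as a multiple of \<open>p\<close>.\<close>
  moreover have "(\<Sum>a\<in>{1..<p}. w ^ a) = -1"
    using sum_w_power[of 1] ge_3 by (simp add: lessThan_p add_eq_0_iff)
  ultimately have "(\<Sum>a<p. (w ^ a) ^ 1 * ipoly P (w ^ a)) = of_int (poly f 1 ^ (p - 1)) - N"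
    by (simp add: lessThan_p sum_distrib_right [symmetric])
  moreover obtain c where "(\<Sum>a<p. (w ^ a) ^ 1 * ipoly P (w ^ a)) = of_int (int p * c)"
    using sum_ipoly_w by blast
  ultimately have "N = of_int (poly f 1 ^ (p - 1)) - of_int (int p * c)"
    by (metis diff_diff_eq2 add_diff_cancel_left')
  then show ?thesis
    unfolding N_def by (metis of_int_diff)
qed

lemma of_int_cyc_norm: "of_int (cyc_norm f) = (\<Prod>j\<in>{1..<p}. ipoly f (w ^ j))"
  using prod_ipoly_w[of f] by (auto simp: cyc_norm_def simp del: of_int_diff)

lemma cyc_norm_cong: "[cyc_norm f = poly f 1 ^ (p - 1)] (mod int p)"
proof -
  obtain c where "of_int (cyc_norm f) = (of_int (poly f 1 ^ (p - 1) - int p * c) :: complex)"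
    using prod_ipoly_w[of f] by (auto simp only: of_int_cyc_norm)
  then have "cyc_norm f = poly f 1 ^ (p - 1) - int p * c"
    by (simp only: of_int_eq_iff)
  then show ?thesis by (simp add: cong_iff_lin)
qed

lemma cyc_norm_cong_poly:
  "(\<And>j. j \<in> {1..<p} \<Longrightarrow> ipoly f (w ^ j) = ipoly g (w ^ j)) \<Longrightarrow> cyc_norm f = cyc_norm g"
  by (simp add: cyc_norm_def)

lemma cyc_norm_mult: "cyc_norm (f * g) = cyc_norm f * cyc_norm g"
proof -
  have "(of_int (cyc_norm (f * g)) :: complex) = of_int (cyc_norm f * cyc_norm g)"
    by (simp add: of_int_cyc_norm prod.distrib)
  then show ?thesis by (simp only: of_int_eq_iff)
qed

text \<open>The product of the factors \<open>X - w^j\<close> is the \<open>p\<close>-th cyclotomic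
  polynomial, whose value at 1 is \<open>p\<close>; the sign disappears because \<open>p - 1\<close>
  is even.\<close>

lemma cyc_norm_linear: "cyc_norm [:-1, 1:] = int p"
proof -
  let ?f = "\<Prod>j\<in>{1..<p}. [:- (w ^ j), 1:]" and ?g = "\<Sum>k<p. monom (1 :: complex) k"
  have deg: "degree ?f = p - 1" by (simp add: degree_prod_eq_sum_degree)
  have "?f = ?g"
  \<comment> \<open>Two polynomials of degree at most \<open>p - 1\<close> with equal coefficients
    there need to agree at only \<open>p - 1\<close> points; here these are the common
    roots.\<close>
  proof (rule poly_eqI_degree_lead_coeff[where n = "p - 1" and A = "(\<lambda>j. w ^ j) ` {1..<p}"])
    have "lead_coeff ?f = 1" by (simp add: lead_coeff_prod)
    then show "coeff ?f (p - 1) = coeff ?g (p - 1)"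
      using ge_3 by (simp only: deg) (simp add: coeff_sum)
    show "card ((\<lambda>j. w ^ j) ` {1..<p}) \<ge> p - 1"
      using inj_w_power by (simp add: lessThan_p card_image inj_on_insert)
    show "degree ?f \<le> p - 1" by (simp only: deg)
    show "degree ?g \<le> p - 1"
      by (rule degree_sum_le) (auto intro: order.trans[OF degree_monom_le])
  next
    fix z assume "z \<in> (\<lambda>j. w ^ j) ` {1..<p}"
    then obtain j where j: "j \<in> {1..<p}" "z = w ^ j" by blast
    then have "\<not> p dvd j" by (auto dest: dvd_imp_le)
    moreover have "(\<Sum>k<p. z ^ k) = (\<Sum>k<p. (w ^ k) ^ j)"
      by (simp add: j power_mult [symmetric] mult.commute)
    moreover have "poly ?f z = 0" using j by (auto simp: poly_prod)
    ultimately show "poly ?f z = poly ?g z"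
      by (simp add: poly_sum poly_monom sum_w_power)
  qed
  then have "poly ?f 1 = poly ?g 1" by simp
  then have "(\<Prod>j\<in>{1..<p}. 1 - w ^ j) = of_nat p"
    by (simp add: poly_prod poly_sum poly_monom)
  moreover have "(\<Prod>j\<in>{1..<p}. w ^ j - 1) = (\<Prod>j\<in>{1..<p}. (-1) * (1 - w ^ j))"
    by simp
  moreover have "even (p - 1)"
    using prime ge_3 prime_odd_nat[of p] by simp
  ultimately have "(\<Prod>j\<in>{1..<p}. w ^ j - 1) = of_nat p"
    by (simp only: prod.distrib) simp
  then have "(of_int (cyc_norm [:-1, 1:]) :: complex) = of_int (int p)"
    by (simp add: of_int_cyc_norm)
  then show ?thesis by (simp only: of_int_eq_iff)
qed

text \<open>The \<open>p\<close>-th cyclotomic polynomial: adding multiples of it shifts the value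
  at 1 by multiples of \<open>p\<close> without changing the norm.\<close>

definition Phi :: "int poly" where
  "Phi = (\<Sum>k<p. monom 1 k)"

lemma ipoly_Phi: "j \<in> {1..<p} \<Longrightarrow> ipoly Phi (w ^ j) = 0"
  using sum_w_power[of j]
  by (auto simp: Phi_def power_mult [symmetric] mult.commute dest: dvd_imp_le)

lemma poly_Phi_1: "poly Phi 1 = int p"
  by (simp add: Phi_def poly_sum poly_monom)

text \<open>The derivative at 1 is \<open>p(p-1)/2\<close>, and \<open>p\<close> is odd.\<close>

lemma dvd_poly_pderiv_Phi: "int p dvd poly (pderiv Phi) 1"
proof -
  have "poly (pderiv Phi) 1 = (\<Sum>k<p. int k)"
    using higher_pderiv_sum[of 1 "\<lambda>k. monom (1 :: int) k" "{..<p}"]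
    by (simp add: Phi_def pderiv_monom poly_sum poly_monom)
  also have "2 * \<dots> = int p * (int p - 1)"
    by (induction p) (simp_all add: algebra_simps)
  finally have "int p dvd 2 * poly (pderiv Phi) 1" by simp
  moreover have "coprime (int p) 2"
    using prime ge_3 prime_odd_nat[of p] by simp
  ultimately show ?thesis by (simp add: coprime_dvd_mult_right_iff)
qed

lemma cyc_norm_ramified:
  assumes "int p dvd poly f 1"
  obtains c where "cyc_norm f = int p * c"
    and "[c = poly (pderiv f) 1 ^ (p - 1)] (mod int p)"
proof -
  from assms obtain m where m: "poly f 1 = int p * m" ..
  \<comment> \<open>Since \<open>f - m * Phi\<close> vanishes at 1, it is divisible by
    \<open>x - 1\<close>; \<open>g\<close> is the quotient.\<close>
  define g where "g = synthetic_div f 1 - smult m (synthetic_div Phi 1)"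
  have Phi: "Phi = [:-1, 1:] * synthetic_div Phi 1 + [:int p:]"
    using synthetic_div_correct'[of 1 Phi] poly_Phi_1 by simp
  have "f = [:-1, 1:] * synthetic_div f 1 + [:int p * m:]"
    using synthetic_div_correct'[of 1 f] m by simp
  moreover have "smult m Phi = [:-1, 1:] * smult m (synthetic_div Phi 1) + [:int p * m:]"
    by (subst Phi) (simp add: smult_add_right mult.commute)
  ultimately have f: "f = [:-1, 1:] * g + smult m Phi"
    unfolding g_def by (simp only: right_diff_distrib)
  have "ipoly f (w ^ j) = ipoly ([:-1, 1:] * g) (w ^ j)" if "j \<in> {1..<p}" for j
    by (subst f) (simp only: ipoly_add ipoly_smult ipoly_Phi[OF that], simp)
  then have "cyc_norm f = int p * cyc_norm g"
    using cyc_norm_cong_poly[of f "[:-1, 1:] * g"] by (simp only: cyc_norm_mult cyc_norm_linear)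
  moreover have "poly (pderiv f) 1 = poly g 1 + m * poly (pderiv Phi) 1"
    by (subst f) (simp only: pderiv_add pderiv_mult pderiv_smult, simp add: pderiv_pCons)
  then have "[poly g 1 = poly (pderiv f) 1] (mod int p)"
    using dvd_poly_pderiv_Phi by (simp add: cong_iff_dvd_diff)
  then have "[cyc_norm g = poly (pderiv f) 1 ^ (p - 1)] (mod int p)"
    using cyc_norm_cong cong_pow cong_trans by blast
  ultimately show thesis by (rule that)
qed

section \<open>Factorisation of the determinant and its exponents\<close>

lemma prime_int: "Factorial_Ring.prime (int p)"
  using prime by simp

lemma group_det_eq:
  "group_det_Zp2 p F = of_int (poly (poly F 1) 1 * cyc_norm (map_poly (\<lambda>q. poly q 1) F) *
     (\<Prod>t<p. cyc_norm (poly F (monom 1 t))))"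
proof -
  have range: "{0..p - 1} = insert 0 {1..<p}"
    using ge_3 by auto
  have row: "(\<Prod>j\<in>insert 0 {1..<p}. eval_xy F (w ^ i) (w ^ j)) =
      (\<Prod>t<p. ipoly (poly F (monom 1 t)) (w ^ i))" if i: "i \<in> {1..<p}" for i
  proof -
    \<comment> \<open>For fixed nonzero \<open>i\<close>, the substitution of \<open>i * t\<close>
      for \<open>j\<close> puts the points on the curves \<open>y = x^t\<close>;
      \<open>j = 0\<close> is split off because only nonzero residues are permuted.\<close>
    have "(\<Prod>j\<in>insert 0 {1..<p}. eval_xy F (w ^ i) (w ^ j)) =
        eval_xy F (w ^ i) ((w ^ i) ^ 0) * (\<Prod>j\<in>{1..<p}. eval_xy F (w ^ i) ((w ^ i) ^ j))"
      using prod_w_mult[OF i, of "eval_xy F (w ^ i)"] by (simp add: power_mult)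
    also have "\<dots> = (\<Prod>t<p. eval_xy F (w ^ i) ((w ^ i) ^ t))"
      by (simp add: lessThan_p)
    finally show ?thesis by (simp only: eval_xy_line)
  qed
  have "group_det_Zp2 p F =
      (\<Prod>j\<in>insert 0 {1..<p}. eval_xy F 1 (w ^ j)) *
      (\<Prod>i\<in>{1..<p}. \<Prod>t<p. ipoly (poly F (monom 1 t)) (w ^ i))"
    unfolding group_det_Zp2_def range using row by simp
  also have "(\<Prod>j\<in>insert 0 {1..<p}. eval_xy F 1 (w ^ j)) =
      of_int (poly (poly F 1) 1 * cyc_norm (map_poly (\<lambda>q. poly q 1) F))"
    by (simp add: eval_xy_1 of_int_cyc_norm ipoly_of_1 poly_map_poly_1)
  also have "(\<Prod>i\<in>{1..<p}. \<Prod>t<p. ipoly (poly F (monom 1 t)) (w ^ i)) =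
      of_int (\<Prod>t<p. cyc_norm (poly F (monom 1 t)))"
    by (subst prod.swap) (simp add: of_int_cyc_norm)
  finally show ?thesis by simp
qed

lemma dvd_group_det:
  assumes "int p dvd poly (poly F 1) 1 * cyc_norm (map_poly (\<lambda>q. poly q 1) F) *
     (\<Prod>t<p. cyc_norm (poly F (monom 1 t)))"
  shows "int p ^ (p + 3) dvd poly (poly F 1) 1 * cyc_norm (map_poly (\<lambda>q. poly q 1) F) *
     (\<Prod>t<p. cyc_norm (poly F (monom 1 t)))"
proof -
  let ?G = "map_poly (\<lambda>q. poly q 1) F"
  define a where "a = poly (pderiv (poly F 1)) 1"
  define b where "b = poly (pderiv ?G) 1"
  have norm_dvdD: "int p dvd poly f 1" if "int p dvd cyc_norm f" for f
    using that cyc_norm_cong[of f] prime_dvd_power[OF prime_int] cong_dvd_iff by blast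
  have F1: "int p dvd poly (poly F 1) 1"
    using assms norm_dvdD[of ?G] norm_dvdD[of "poly F (monom 1 _)"]
    by (auto simp: prime_dvd_mult_iff[OF prime_int] prime_dvd_prod_iff[OF _ prime_int]
        poly_map_poly_1 poly_line_1)
  obtain c where c: "cyc_norm ?G = int p * c" "[c = b ^ (p - 1)] (mod int p)"
    using cyc_norm_ramified[of ?G] F1 unfolding b_def poly_map_poly_1 by blast
  have "\<exists>c. cyc_norm (poly F (monom 1 t)) = int p * c \<and>
      [c = (a + int t * b) ^ (p - 1)] (mod int p)" for t
    using cyc_norm_ramified[of "poly F (monom 1 t)"] F1
    unfolding a_def b_def poly_line_1 poly_pderiv_line by blast
  then obtain d where d: "\<And>t. cyc_norm (poly F (monom 1 t)) = int p * d t"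
    "\<And>t. [d t = (a + int t * b) ^ (p - 1)] (mod int p)" by metis
  \<comment> \<open>Each of the \<open>p + 2\<close> factors already supplies one \<open>p\<close>;
    this is the additional one. It comes from the line \<open>x = 1\<close> if \<open>p\<close>
    divides \<open>b\<close>, and otherwise from one of the other \<open>p\<close> lines.\<close>
  have "int p dvd c * (\<Prod>t<p. d t)"
  proof (cases "int p dvd b")
    case True
    then have "int p dvd b ^ (p - 1)"
      using ge_3 by (simp add: dvd_trans[OF _ dvd_power])
    then show ?thesis using c(2) by (simp add: cong_dvd_iff)
  next
    case False
    then have "coprime b (int p)"
      using prime_imp_coprime[OF prime_int] by (simp add: coprime_commute)
    then obtain x where x: "[b * x = 1] (mod int p)"
      using cong_solve_coprime_int by blast
    \<comment> \<open>The solution of \<open>a + t b = 0\<close> modulo \<open>p\<close>, reduced so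
      that it indexes one of the lines.\<close>
    define t where "t = nat ((- a * x) mod int p)"
    have t: "t < p" "int t = (- a * x) mod int p"
      using ge_3 by (auto simp: t_def nat_less_iff)
    have "[a + int t * b = a + (- a * x) * b] (mod int p)"
      unfolding t by (intro cong_add cong_mult) (simp_all add: cong_def)
    also have "a + (- a * x) * b = a - a * (b * x)"
      by (simp add: algebra_simps)
    also have "[\<dots> = a - a * 1] (mod int p)"
      by (intro cong_diff cong_mult x cong_refl)
    finally have "int p dvd a + int t * b" by (simp add: cong_0_iff)
    then have "int p dvd (a + int t * b) ^ (p - 1)"
      using ge_3 by (simp add: dvd_trans[OF _ dvd_power])
    then have "int p dvd d t" using d(2) cong_dvd_iff by blast
    then show ?thesis using t(1) by (meson dvd_mult dvd_prodI dvd_trans finite_lessThan lessThan_iff)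
  qed
  then have "int p * int p * int p ^ p * int p dvd
      poly (poly F 1) 1 * int p * int p ^ p * (c * (\<Prod>t<p. d t))"
    by (intro mult_dvd_mono F1 dvd_refl)
  then show ?thesis
    by (simp add: c(1) d(1) prod.distrib power_add numeral_3_eq_3 mult_ac)
qed

text \<open>Here \<open>F(1,1) = p^(k+1)\<close>, the line \<open>x = 1\<close> contributes exactly
  \<open>p^2\<close>, and each of the other \<open>p\<close> lines exactly one \<open>p\<close>.
  Thus \<open>k\<close> enters only through \<open>F(1,1)\<close>.\<close>

lemma group_det_witness:
  fixes k
  defines "F \<equiv> [:[:-1, 1:]:] + [:-1, 1:] ^ 2 + smult [:int p ^ k:] (\<Sum>j<p. monom 1 j)"
  obtains u where "group_det_Zp2 p F = of_int (int p ^ (p + 3 + k) * u)" and "\<not> int p dvd u"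
proof -
  let ?G = "map_poly (\<lambda>q. poly q (1 :: int)) F"
  have hom: "map_poly (\<lambda>q. poly q (1 :: int)) (A + B) =
      map_poly (\<lambda>q. poly q 1) A + map_poly (\<lambda>q. poly q 1) B" for A B
    by (rule poly_eqI) (simp add: coeff_map_poly)
  have "map_poly (\<lambda>q. poly q (1 :: int)) (\<Sum>j<p. monom 1 j) = Phi"
    by (rule poly_eqI) (simp add: coeff_map_poly coeff_sum Phi_def poly_sum
        if_distrib [where f = "\<lambda>q. poly q 1"] cong: if_cong)
  moreover have "map_poly (\<lambda>q. poly q (1 :: int)) (smult [:int p ^ k:] A) =
      smult (int p ^ k) (map_poly (\<lambda>q. poly q 1) A)" for A
    by (rule poly_eqI) (simp add: coeff_map_poly)
  ultimately have G: "?G = [:-1, 1:] ^ 2 + smult (int p ^ k) Phi"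
    unfolding F_def hom by (simp add: map_poly_pCons power2_eq_square)
  have F1: "poly F 1 = [:-1, 1:] + [:int p ^ k * int p:]"
    by (simp add: F_def poly_sum poly_monom of_nat_poly)
  \<comment> \<open>At nontrivial roots of unity the \<open>Phi\<close> term vanishes and only
    \<open>(y-1)^2\<close> remains.\<close>
  have "cyc_norm ?G = cyc_norm ([:-1, 1:] * [:-1, 1:])"
    unfolding G by (rule cyc_norm_cong_poly) (simp add: ipoly_Phi power2_eq_square)
  then have normG: "cyc_norm ?G = int p * int p"
    by (simp only: cyc_norm_mult cyc_norm_linear)
  have dG: "int p dvd poly (pderiv ?G) 1"
    unfolding G using dvd_poly_pderiv_Phi
    by (simp add: pderiv_add pderiv_smult pderiv_mult power2_eq_square pderiv_pCons)
  have "\<exists>c. cyc_norm (poly F (monom 1 t)) = int p * c \<and> \<not> int p dvd c" for t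
  proof -
    \<comment> \<open>As \<open>p\<close> divides the \<open>y\<close>-derivative, this is 1 modulo
      \<open>p\<close> for every \<open>t\<close>, so no second factor \<open>p\<close> appears on
      these lines.\<close>
    have "poly (pderiv (poly F (monom 1 t))) 1 = 1 + int t * poly (pderiv ?G) 1"
      unfolding poly_pderiv_line unfolding F1 by (simp add: pderiv_add pderiv_pCons)
    then have "\<not> int p dvd poly (pderiv (poly F (monom 1 t))) 1"
      using dG ge_3 by (simp add: dvd_add_left_iff)
    then have *: "\<not> int p dvd poly (pderiv (poly F (monom 1 t))) 1 ^ (p - 1)"
      using prime_dvd_power[OF prime_int] by blast
    have "int p dvd poly (poly F (monom 1 t)) 1"
      unfolding poly_line_1 F1 by simp
    then obtain c where "cyc_norm (poly F (monom 1 t)) = int p * c"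
      "[c = poly (pderiv (poly F (monom 1 t))) 1 ^ (p - 1)] (mod int p)"
      by (rule cyc_norm_ramified)
    with * show ?thesis using cong_dvd_iff by blast
  qed
  then obtain d where d: "\<And>t. cyc_norm (poly F (monom 1 t)) = int p * d t" "\<And>t. \<not> int p dvd d t"
    by metis
  have "group_det_Zp2 p F = of_int (int p ^ (p + 3 + k) * (\<Prod>t<p. d t))"
    unfolding group_det_eq normG F1 d(1)
    by (simp add: prod.distrib power_add numeral_3_eq_3 mult_ac)
  moreover have "\<not> int p dvd (\<Prod>t<p. d t)"
    using d(2) by (simp add: prime_dvd_prod_iff[OF _ prime_int])
  ultimately show thesis by (rule that)
qed

end

theorem theorem1:
  fixes p :: nat
  assumes "prime p" and "p \<ge> 3"
  shows "(\<forall>F :: int poly poly. \<exists>M :: int. group_det_Zp2 p F = of_int M \<and>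
            (int p dvd M \<longrightarrow> int p ^ (p + 3) dvd M)) \<and>
         (\<forall>k :: nat. \<exists>(F :: int poly poly) (M :: int). group_det_Zp2 p F = of_int M \<and>
            int p ^ (p + 3 + k) dvd M \<and> \<not> int p ^ (p + 4 + k) dvd M)"
proof -
  interpret odd_prime p by standard (fact assms)+
  show ?thesis
  proof (intro conjI allI)
    fix F
    show "\<exists>M. group_det_Zp2 p F = of_int M \<and> (int p dvd M \<longrightarrow> int p ^ (p + 3) dvd M)"
      using group_det_eq dvd_group_det by blast
  next
    fix k
    obtain F u where F: "group_det_Zp2 p F = of_int (int p ^ (p + 3 + k) * u)" "\<not> int p dvd u"
      using group_det_witness by blast
    have "int p ^ (p + 4 + k) = int p ^ (p + 3 + k) * int p"
      by (simp add: power_add numeral_eq_Suc)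
    then have "\<not> int p ^ (p + 4 + k) dvd int p ^ (p + 3 + k) * u"
      using F(2) ge_3 by (simp only: dvd_mult_cancel_left) simp
    with F(1) show "\<exists>F M. group_det_Zp2 p F = of_int M \<and>
        int p ^ (p + 3 + k) dvd M \<and> \<not> int p ^ (p + 4 + k) dvd M"
      using dvd_triv_left by blast
  qed
qed

end
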